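(* Let $k\ge1$, $\rho>0$ and $p_{\mathrm{FA}}\in(0,1)$. Consider the testing problem with training data, with unknown $\mu_1\in\mathbb{R}^k\setminus\{0\}$, $$\mathcal{H}_0:(X,Y)\sim\mathcal{N}_k\!\left(\mu_1,\tfrac1\rho I\right)\times\mathcal{N}_k(0,I),\qquad \mathcal{H}_1:(X,Y)\sim\mathcal{N}_k\!\left(\mu_1,\tfrac1\rho I\right)\times\mathcal{N}_k(\mu_1,I).$$ Then the discriminant rule $\underline{R}_x$ that accepts $\mathcal{H}_0$ (outputs $0$) when $$\|\rho x+y\|^2<Q^{-1}_{(k),\vartheta_0}(p_{\mathrm{FA}}),\qquad \vartheta_0=\|\rho x\|^2,$$ and outputs $1$ otherwise is a universal minimax (UMM) detector with a training sequence and guaranteed significance level $p_{\mathrm{FA}}$. Its missed-detection probability against $\mu_1$ is $$\underline{p}^{\mathrm{umm}}_{\mathrm{MD}}(p_{\mathrm{FA}},\Delta,\rho,k)=1-E\left[Q_{(k),\vartheta_1}\!\left(Q^{-1}_{(k),\vartheta_0}(p_{\mathrm{FA}})\right)\right],$$ where $\Delta=\|\mu_1\|$, $\vartheta_0=\|\rho X\|^2$, $\vartheta_1=\|\rho X+\mu_1\|^2$, and the expectation is over $X\sim\mathcal{N}_k(\mu_1,\frac1\rho I)$.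
   Context: $Q_{(k),\lambda}(t)=P(Z>t)$ is the tail function of the non-central $\chi^2$ distribution with $k$ degrees of freedom and non-centrality parameter $\lambda$ (the law of $\|G\|^2$ with $G\sim\mathcal{N}_k(m,I)$, $\|m\|^2=\lambda$), and $Q^{-1}_{(k),\lambda}$ is its inverse. A detector with a training sequence is a (possibly randomized) statistic $R_x(y)\in\{0,1\}$ of $(x,y)$. Its conditional false-alarm probability is $p_{\mathrm{FA}}(R_x|x)=P(R_x(Y)=1\mid X=x)$ with $Y\sim\mathcal{N}_k(0,I)$, and its (average) missed-detection probability is $p_{\mathrm{MD}}(R_x;\mu_1)=P(R_X(Y)=0)$ with $X\sim\mathcal{N}_k(\mu_1,\frac1\rho I)$ and $Y\sim\mathcal{N}_k(\mu_1,I)$ independent. Let $\underline{\mathcal{R}}(p)=\{R_x: p_{\mathrm{FA}}(R_x|x)\le p\ \text{for all }x\in\mathbb{R}^k\}$ (detectors with guaranteed significance level $p$). Hardness is defined by the problem without training data: $p^*_{\mathrm{MD}}(p;\mu)$ is the minimum missed-detection probability over all tests of $\mathcal{N}_k(0,I)$ versus $\mathcal{N}_k(\mu,I)$ based on $Y$ with false-alarm probability at most $p$; $\mu'\preccurlyeq\mu$ if $p^*_{\mathrm{MD}}(p;\mu)\le p^*_{\mathrm{MD}}(p;\mu')$ for all $0<p<1$; the minimax sets are $\tilde\Theta_\mu=\{\mu_1\neq0:\mu\preccurlyeq\mu_1\}$, $\mu\ne0$. Here they are exactly the sets $\{\mu_1\ne0:\|\mu_1\|\ge d\}$, $d>0$.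 $R^*_x$ is a UMM detector with a training sequence and guaranteed significance level $p_{\mathrm{FA}}$ if $R^*_x\in\underline{\mathcal{R}}(p_{\mathrm{FA}})$ and it minimizes $\sup_{\mu_1\in\tilde\Theta_\mu}p_{\mathrm{MD}}(R_x;\mu_1)$ among all detectors in $\underline{\mathcal{R}}(p_{\mathrm{FA}})$, simultaneously for all minimax sets $\tilde\Theta_\mu$, $\mu\neq0$. *)

theory Defs
  imports "HOL-Probability.Probability"
begin

text \<open>The law \<open>N_k(m, v I)\<close> on \<open>real ^ 'n\<close>, where \<open>k = CARD('n)\<close>; the parameter \<open>v\<close> is the variance,
  whereas \<^const>\<open>normal_density\<close> takes the standard deviation.\<close>

definition gaussian :: "real ^ 'n \<Rightarrow> real \<Rightarrow> (real ^ 'n) measure" where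
  "gaussian m v = density lborel (\<lambda>x. \<Prod>i\<in>UNIV. ennreal (normal_density (m $ i) (sqrt v) (x $ i)))"

text \<open>The number of degrees of freedom is \<open>CARD('n)\<close>, carried by a type argument. The choice of the
  mean is immaterial, see \<open>noncentral_chi2_eq\<close> below.\<close>

definition noncentral_chi2 :: "'n::finite itself \<Rightarrow> real \<Rightarrow> real measure" where
  "noncentral_chi2 (k :: 'n itself) l =
     distr (gaussian (SOME m :: real ^ 'n. (norm m)\<^sup>2 = l) 1) borel (\<lambda>g. (norm g)\<^sup>2)"

definition chi2_tail :: "'n::finite itself \<Rightarrow> real \<Rightarrow> real \<Rightarrow> real" where
  "chi2_tail k l t = measure (noncentral_chi2 k l) {t<..}"

text \<open>The tail is \<open>1\<close> on all of \<open>{..0}\<close>, so it is inverted on the half-line \<open>{0..}\<close>.\<close>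

definition chi2_tail_inv :: "'n::finite itself \<Rightarrow> real \<Rightarrow> real \<Rightarrow> real" where
  "chi2_tail_inv k l = the_inv_into {0..} (chi2_tail k l)"

lemma gaussian_radial:
  fixes m :: "real ^ 'n"
  shows "gaussian m 1 =
    density lborel (\<lambda>x. ennreal ((1 / sqrt (2 * pi)) ^ CARD('n) * exp (- (norm (x - m))\<^sup>2 / 2)))"
proof -
  have "(\<Prod>i\<in>UNIV. ennreal (normal_density (m $ i) (sqrt 1) (x $ i))) =
      ennreal ((1 / sqrt (2 * pi)) ^ CARD('n) * exp (- (norm (x - m))\<^sup>2 / 2))" for x :: "real ^ 'n"
  proof -
    have "(norm (x - m))\<^sup>2 = (\<Sum>i\<in>UNIV. (x $ i - m $ i)\<^sup>2)"
      by (simp add: norm_vec_def L2_set_def sum_nonneg)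
    then have "- (norm (x - m))\<^sup>2 / 2 = (\<Sum>i\<in>UNIV. - (x $ i - m $ i)\<^sup>2 / 2)"
      by (simp add: sum_negf sum_divide_distrib)
    then show ?thesis
      by (simp add: prod_ennreal normal_density_def prod.distrib prod_constant exp_sum
          power_one_over prod_dividef)
  qed
  then show ?thesis
    unfolding gaussian_def by presburger
qed

text \<open>The library fact \<open>measure_orthogonal_image\<close> needs a wellordered index type, hence the direct
  argument via Vitali coverings by balls.\<close>

lemma emeasure_lborel_orthogonal_vimage:
  fixes f g :: "'a::euclidean_space \<Rightarrow> 'a"
  assumes g: "orthogonal_transformation g" and f: "f \<in> borel_measurable borel"
    and inv: "\<And>x. f (g x) = x" "\<And>x. g (f x) = x"
    and S: "open S"
  shows "emeasure lborel (f -` S) = emeasure lborel S"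
proof -
  have img: "f -` A = g ` A" for A
    using inv by (auto simp: image_iff) (metis inv(2))
  define K where "K = {(a, r). r > 0 \<and> ball a r \<subseteq> S}"
  have "\<exists>i. i \<in> K \<and> x \<in> ball (fst i) (snd i) \<and> snd i < d" if x: "x \<in> S" and d: "0 < d" for x d
  proof -
    obtain e where e: "e > 0" "ball x e \<subseteq> S"
      using S x openE by blast
    have "ball x (min e (d / 2)) \<subseteq> S"
      using e(2) by (auto simp: subset_iff)
    then have "(x, min e (d / 2)) \<in> K"
      using e(1) d by (simp add: K_def)
    then show ?thesis
      using e(1) d by (intro exI[of _ "(x, min e (d / 2))"]) auto
  qed
  then obtain C where C: "countable C" "C \<subseteq> K"
      "pairwise (\<lambda>i j. disjnt (ball (fst i) (snd i)) (ball (fst j) (snd j))) C"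
      "negligible (S - (\<Union>i\<in>C. ball (fst i) (snd i)))"
    by (rule Vitali_covering_theorem_balls)
  define U where "U = (\<Union>i\<in>C. ball (fst i) (snd i))"
  have "ball (fst i) (snd i) \<subseteq> S" if "i \<in> C" for i
    using subsetD[OF C(2) that] by (cases i) (simp add: K_def)
  then have U: "U \<subseteq> S" "open U"
    by (auto simp: U_def simp del: mem_ball)
  have dj: "disjoint_family_on (\<lambda>i. ball (fst i) (snd i)) C"
    using C(3) by (auto simp: disjoint_family_on_def pairwise_def disjnt_def)
  have dj': "disjoint_family_on (\<lambda>i. f -` ball (fst i) (snd i)) C"
    using dj unfolding disjoint_family_on_def by (metis vimage_Int vimage_empty)
  have bor: "f -` A \<in> sets lborel" if "A \<in> sets borel" for A
    using measurable_sets_borel[OF f that] by simp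
  have "emeasure lborel (f -` U) = emeasure lborel (\<Union>i\<in>C. f -` ball (fst i) (snd i))"
    by (simp add: U_def vimage_UN)
  also have "\<dots> = (\<integral>\<^sup>+i. emeasure lborel (f -` ball (fst i) (snd i)) \<partial>count_space C)"
    using C(1) dj' bor by (intro emeasure_UN_countable) auto
  also have "\<dots> = (\<integral>\<^sup>+i. emeasure lborel (ball (fst i) (snd i)) \<partial>count_space C)"
  proof (rule nn_integral_cong)
    fix i assume "i \<in> space (count_space C)"
    then have "snd i > 0"
      using C(2) by (auto simp: K_def)
    then show "emeasure lborel (f -` ball (fst i) (snd i)) = emeasure lborel (ball (fst i) (snd i))"
      unfolding img image_orthogonal_transformation_ball[OF g] by (simp add: emeasure_ball)
  qed
  also have "\<dots> = emeasure lborel U"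
    unfolding U_def using C(1) dj by (intro emeasure_UN_countable[symmetric]) auto
  finally have eqU: "emeasure lborel (f -` U) = emeasure lborel U" .
  have neg: "negligible (S - U)"
    using C(4) by (simp add: U_def)
  then have neg': "negligible (f -` (S - U))"
    unfolding img using orthogonal_transformation_linear[OF g]
    by (intro negligible_differentiable_image_negligible linear_imp_differentiable_on) auto
  have split: "emeasure lborel (f -` S) = emeasure lborel (f -` U) + emeasure lborel (f -` (S - U))"
    using U S by (subst plus_emeasure) (auto intro!: bor[simplified] arg_cong[where f="emeasure lborel"])
  have split': "emeasure lborel S = emeasure lborel U + emeasure lborel (S - U)"
    using U S by (subst plus_emeasure) (auto intro!: arg_cong[where f="emeasure lborel"])
  have "emeasure lborel (S - U) = 0"
    using neg U S by (simp add: negligible_iff_emeasure0)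
  moreover have "emeasure lborel (f -` (S - U)) = 0"
    using neg' bor[of "S - U"] U S by (simp add: negligible_iff_emeasure0)
  ultimately show ?thesis
    using split split' eqU by simp
qed

lemma lborel_distr_orthogonal:
  fixes f :: "'a::euclidean_space \<Rightarrow> 'a"
  assumes f: "orthogonal_transformation f"
  shows "distr lborel borel f = lborel"
proof (rule lborel_eqI[symmetric])
  have bij: "bij f"
    using f by (rule orthogonal_transformation_bij)
  have g: "orthogonal_transformation (inv f)" "\<And>x. f (inv f x) = x" "\<And>x. inv f (f x) = x"
    using f bij by (auto simp: orthogonal_transformation_inv bij_is_surj surj_f_inv_f bij_is_inj)
  have fm: "f \<in> borel_measurable borel"
    using f by (intro borel_measurable_continuous_onI linear_continuous_on)
      (simp add: linear_conv_bounded_linear[symmetric] orthogonal_transformation_linear)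
  fix l u :: 'a
  assume lu: "\<And>b. b \<in> Basis \<Longrightarrow> l \<bullet> b \<le> u \<bullet> b"
  have "emeasure (distr lborel borel f) (box l u) = emeasure lborel (f -` box l u)"
    using fm by (subst emeasure_distr) auto
  also have "\<dots> = emeasure lborel (box l u)"
    by (rule emeasure_lborel_orthogonal_vimage[OF g(1) fm g(2,3) open_box])
  finally show "emeasure (distr lborel borel f) (box l u) = (\<Prod>b\<in>Basis. (u - l) \<bullet> b)"
    using lu by (simp add: emeasure_lborel_box)
qed simp

lemma noncentral_chi2_eq:
  fixes m :: "real ^ 'n"
  assumes "(norm m)\<^sup>2 = l"
  shows "noncentral_chi2 TYPE('n) l = distr (gaussian m 1) borel (\<lambda>g. (norm g)\<^sup>2)"
proof -
  define m' :: "real ^ 'n" where "m' = (SOME m. (norm m)\<^sup>2 = l)"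
  have "(norm m')\<^sup>2 = l"
    unfolding m'_def by (rule someI[of _ m]) fact
  then have "norm m = norm m'"
    using assms by (metis norm_ge_zero power2_eq_imp_eq)
  then obtain f :: "real ^ 'n \<Rightarrow> real ^ 'n" where f: "orthogonal_transformation f" "f m = m'"
    by (metis orthogonal_transformation_exists)
  have fm: "f \<in> borel_measurable borel"
    using f(1) by (intro borel_measurable_continuous_onI linear_continuous_on)
      (simp add: linear_conv_bounded_linear[symmetric] orthogonal_transformation_linear)
  have nrm: "norm (f x - m') = norm (x - m)" "norm (f x) = norm x" for x
    using f by (metis orthogonal_transformation_norm orthogonal_transformation_linear linear_diff)+
  define h where
    "h = (\<lambda>x. ennreal ((1 / sqrt (2 * pi)) ^ CARD('n) * exp (- (norm (x - m'))\<^sup>2 / 2)))"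
  have h: "h \<in> borel_measurable borel"
    unfolding h_def by measurable
  have "gaussian m' 1 = density (distr lborel borel f) h"
    unfolding gaussian_radial h_def lborel_distr_orthogonal[OF f(1)] ..
  also have "\<dots> = distr (density lborel (\<lambda>x. h (f x))) borel f"
    using h fm by (intro density_distr) auto
  also have "density lborel (\<lambda>x. h (f x)) = gaussian m 1"
    unfolding gaussian_radial h_def nrm ..
  finally have "noncentral_chi2 TYPE('n) l
      = distr (distr (gaussian m 1) borel f) borel (\<lambda>g. (norm g)\<^sup>2)"
    unfolding noncentral_chi2_def m'_def by simp
  also have "\<dots> = distr (gaussian m 1) borel (\<lambda>g. (norm g)\<^sup>2)"
    using fm by (subst distr_distr) (auto simp: gaussian_def o_def nrm)
  finally show ?thesis .
qed

text \<open>Randomized decisions are Markov kernels into \<^typ>\<open>bool\<close>; \<^const>\<open>True\<close> is the output \<open>1\<close>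
  (reject the null hypothesis) and \<^const>\<open>False\<close> the output \<open>0\<close>.\<close>

abbreviation decision_space :: "bool measure" where
  "decision_space \<equiv> count_space UNIV"

definition tests :: "(real ^ 'n \<Rightarrow> bool measure) set" where
  "tests = borel \<rightarrow>\<^sub>M prob_algebra decision_space"

definition test_fa :: "(real ^ 'n \<Rightarrow> bool measure) \<Rightarrow> real" where
  "test_fa T = measure (gaussian 0 1 \<bind> T) {True}"

definition test_md :: "(real ^ 'n \<Rightarrow> bool measure) \<Rightarrow> real ^ 'n \<Rightarrow> real" where
  "test_md T mu = measure (gaussian mu 1 \<bind> T) {False}"

text \<open>The constraint set contains the constant decision \<^const>\<open>False\<close> whenever \<open>p \<ge> 0\<close>, and the
  minimum is attained by a likelihood-ratio test, so the infimum is the minimum.\<close>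

definition opt_md :: "real \<Rightarrow> real ^ 'n \<Rightarrow> real" where
  "opt_md p mu = (INF T\<in>{T \<in> tests. test_fa T \<le> p}. test_md T mu)"

text \<open>\<open>harder mu' mu\<close>: the alternative \<open>mu'\<close> is at least as hard to detect as \<open>mu\<close>.\<close>

definition harder :: "real ^ 'n \<Rightarrow> real ^ 'n \<Rightarrow> bool" where
  "harder mu' mu \<longleftrightarrow> (\<forall>p. 0 < p \<and> p < 1 \<longrightarrow> opt_md p mu \<le> opt_md p mu')"

definition minimax_set :: "real ^ 'n \<Rightarrow> (real ^ 'n) set" where
  "minimax_set mu = {mu1. mu1 \<noteq> 0 \<and> harder mu mu1}"

type_synonym 'n detector = "real ^ 'n \<Rightarrow> real ^ 'n \<Rightarrow> bool measure"

definition detectors :: "'n::finite detector set" where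
  "detectors = {R. (\<lambda>(x, y). R x y) \<in> borel \<Otimes>\<^sub>M borel \<rightarrow>\<^sub>M prob_algebra decision_space}"

definition p_fa :: "'n::finite detector \<Rightarrow> real ^ 'n \<Rightarrow> real" where
  "p_fa R x = measure (gaussian 0 1 \<bind> R x) {True}"

text \<open>\<open>rho\<close> is the precision of the training observation \<open>X\<close>, which is independent of \<open>Y\<close>.\<close>

definition p_md :: "real \<Rightarrow> 'n::finite detector \<Rightarrow> real ^ 'n \<Rightarrow> real" where
  "p_md rho R mu1 =
     measure ((gaussian mu1 (1 / rho) \<Otimes>\<^sub>M gaussian mu1 1) \<bind> (\<lambda>(x, y). R x y)) {False}"

definition guaranteed_detectors :: "real \<Rightarrow> 'n::finite detector set" where
  "guaranteed_detectors p = {R \<in> detectors. \<forall>x. p_fa R x \<le> p}"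

text \<open>The suprema range over nonempty sets, as \<open>mu \<in> minimax_set mu\<close> for \<open>mu \<noteq> 0\<close>, and are bounded
  by \<open>1\<close>.\<close>

definition umm_detector :: "real \<Rightarrow> real \<Rightarrow> 'n::finite detector \<Rightarrow> bool" where
  "umm_detector rho p R \<longleftrightarrow>
     R \<in> guaranteed_detectors p \<and>
     (\<forall>mu. mu \<noteq> 0 \<longrightarrow>
       (\<forall>R' \<in> guaranteed_detectors p.
          (SUP mu1\<in>minimax_set mu. p_md rho R mu1) \<le> (SUP mu1\<in>minimax_set mu. p_md rho R' mu1)))"

definition discriminant_rule :: "real \<Rightarrow> real \<Rightarrow> 'n::finite detector" where
  "discriminant_rule rho p x y =
     return decision_space
       (\<not> (norm (rho *\<^sub>R x + y))\<^sup>2 < chi2_tail_inv TYPE('n) ((norm (rho *\<^sub>R x))\<^sup>2) p)"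

end

theory Submission
  imports Defs
begin

text \<open>Average the missed-detection probability of a detector over \<open>mu1\<close> uniform on the sphere of radius
  \<open>d\<close>. For fixed \<open>x\<close> the averaged likelihood ratio of \<open>y\<close> is a nondecreasing function of
  \<open>norm (rho *\<^sub>R x + y)\<close>, so by the Neyman--Pearson argument the discriminant rule minimizes the average
  among detectors with guaranteed significance level \<open>p\<close>. Its own missed-detection probability is constant
  on spheres, hence is at most the supremum over the sphere for any competitor. As the minimax sets
  are unions of spheres, optimality on each of them follows; neither their explicit form nor the
  monotonicity of the power in \<open>norm mu1\<close> is needed.\<close>

section \<open>Isotropic Gaussian measures\<close>

lemma sets_gaussian [simp, measurable_cong]: "sets (gaussian m v) = sets borel"
  by (simp add: gaussian_def)

lemma space_gaussian [simp]: "space (gaussian m v) = UNIV"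
  by (simp add: gaussian_def)

text \<open>Rewritten as a product over \<open>Basis\<close>, the density integrates coordinate by
  coordinate, and each factor is a one-dimensional normal density of mass 1.\<close>

lemma prob_space_gaussian:
  fixes m :: "real ^ 'n"
  assumes "v > 0"
  shows "prob_space (gaussian m v)"
proof
  define f where "f b t = ennreal (normal_density (m \<bullet> b) (sqrt v) t)" for b :: "real ^ 'n" and t
  have "(\<Prod>i\<in>UNIV. ennreal (normal_density (m $ i) (sqrt v) (x $ i))) = (\<Prod>b\<in>Basis. f b (x \<bullet> b))"
    for x :: "real ^ 'n"
  proof -
    have "(\<Prod>b\<in>Basis. f b (x \<bullet> b)) = (\<Prod>b\<in>range (\<lambda>i. axis i (1::real)). f b (x \<bullet> b))"
      by (simp add: Basis_vec_def UNION_singleton_eq_range)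
    also have "\<dots> = (\<Prod>i\<in>UNIV. f (axis i 1) (x \<bullet> axis i 1))"
      by (subst prod.reindex) (auto simp: inj_on_def axis_eq_axis)
    finally show ?thesis
      by (simp add: f_def inner_axis)
  qed
  then have "emeasure (gaussian m v) (space (gaussian m v)) =
      (\<integral>\<^sup>+x. (\<Prod>b\<in>Basis. f b (x \<bullet> b)) \<partial>lborel)"
    by (simp add: gaussian_def emeasure_density f_def)
  also have "\<dots> = (\<Prod>b\<in>(Basis :: (real ^ 'n) set). \<integral>\<^sup>+t. f b t \<partial>lborel)"
    by (rule nn_integral_lborel_prod) (auto simp: f_def)
  also have "\<dots> = 1"
    unfolding f_def using assms
    by (intro prod.neutral ballI) (subst nn_integral_eq_integral, auto)
  finally show "emeasure (gaussian m v) (space (gaussian m v)) = 1" .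
qed

lemma gaussian_eq_density:
  fixes m :: "real ^ 'n"
  assumes v: "v > 0"
  shows "gaussian m v =
    density lborel (\<lambda>x. ennreal ((1 / sqrt (2 * pi * v)) ^ CARD('n) * exp (- (norm (x - m))\<^sup>2 / (2 * v))))"
proof -
  have "(\<Prod>i\<in>UNIV. ennreal (normal_density (m $ i) (sqrt v) (x $ i))) =
      ennreal ((1 / sqrt (2 * pi * v)) ^ CARD('n) * exp (- (norm (x - m))\<^sup>2 / (2 * v)))" for x :: "real ^ 'n"
  proof -
    have "(norm (x - m))\<^sup>2 = (\<Sum>i\<in>UNIV. (x $ i - m $ i)\<^sup>2)"
      by (simp add: norm_vec_def L2_set_def sum_nonneg)
    then have "- (norm (x - m))\<^sup>2 / (2 * v) = (\<Sum>i\<in>UNIV. - (x $ i - m $ i)\<^sup>2 / (2 * v))"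
      by (simp add: sum_negf sum_divide_distrib)
    then show ?thesis
      using v by (simp add: prod_ennreal normal_density_def prod.distrib prod_constant exp_sum
          power_one_over prod_dividef)
  qed
  then show ?thesis
    unfolding gaussian_def by presburger
qed

lemma measurable_orthogonal_transformation:
  fixes f :: "'a::euclidean_space \<Rightarrow> 'a"
  assumes "orthogonal_transformation f"
  shows "f \<in> borel_measurable borel"
  using assms by (intro borel_measurable_continuous_onI linear_continuous_on)
    (simp add: linear_conv_bounded_linear[symmetric] orthogonal_transformation_linear)

text \<open>Lebesgue measure is invariant under \<open>f\<close> and the density depends only on the
  distance to the mean, so only the mean moves.\<close>

lemma distr_gaussian_orthogonal:
  fixes f :: "real ^ 'n \<Rightarrow> real ^ 'n"
  assumes f: "orthogonal_transformation f" and v: "v > 0"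
  shows "distr (gaussian m v) borel f = gaussian (f m) v"
proof -
  have [measurable]: "f \<in> borel_measurable borel"
    using f by (rule measurable_orthogonal_transformation)
  have nrm: "norm (f x - f m) = norm (x - m)" for x
    using f by (metis orthogonal_transformation_norm orthogonal_transformation_linear linear_diff)
  define h where
    "h x = ennreal ((1 / sqrt (2 * pi * v)) ^ CARD('n) * exp (- (norm (x - f m))\<^sup>2 / (2 * v)))" for x
  have [measurable]: "h \<in> borel_measurable borel"
    unfolding h_def by measurable
  have "gaussian (f m) v = density (distr lborel borel f) h"
    unfolding gaussian_eq_density[OF v] h_def lborel_distr_orthogonal[OF f] ..
  also have "\<dots> = distr (density lborel (\<lambda>x. h (f x))) borel f"
    by (intro density_distr) auto
  also have "density lborel (\<lambda>x. h (f x)) = gaussian m v"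
    unfolding gaussian_eq_density[OF v] h_def nrm ..
  finally show ?thesis ..
qed

lemma distr_gaussian_translation:
  fixes m :: "real ^ 'n"
  assumes v: "v > 0"
  shows "distr (gaussian m v) borel ((+) a) = gaussian (a + m) v"
proof -
  define h where
    "h x = ennreal ((1 / sqrt (2 * pi * v)) ^ CARD('n) * exp (- (norm (x - (a + m)))\<^sup>2 / (2 * v)))" for x
  have [measurable]: "h \<in> borel_measurable borel"
    unfolding h_def by measurable
  have "gaussian (a + m) v = density (distr lborel borel ((+) a)) h"
    unfolding gaussian_eq_density[OF v] h_def lborel_distr_plus ..
  also have "\<dots> = distr (density lborel (\<lambda>x. h (a + x))) borel ((+) a)"
    by (intro density_distr) auto
  also have "density lborel (\<lambda>x. h (a + x)) = gaussian m v"
    unfolding gaussian_eq_density[OF v] h_def by (simp add: algebra_simps)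
  finally show ?thesis ..
qed

text \<open>Expanding the square splits off the centred density. The remaining exponential is the
  likelihood ratio used for every change of measure below.\<close>

lemma gaussian_tilt:
  fixes m :: "real ^ 'n"
  assumes v: "v > 0"
  shows "gaussian m v =
    density (gaussian 0 v) (\<lambda>x. ennreal (exp ((x \<bullet> m) / v - (norm m)\<^sup>2 / (2 * v))))"
proof -
  have "exp (- (norm (x - m))\<^sup>2 / (2 * v)) =
      exp (- (norm x)\<^sup>2 / (2 * v)) * exp ((x \<bullet> m) / v - (norm m)\<^sup>2 / (2 * v))" for x
    using v by (simp add: power2_norm_eq_inner inner_diff inner_commute field_simps flip: exp_add)
  then show ?thesis
    unfolding gaussian_eq_density[OF v]
    by (subst density_density_eq) (auto simp: ennreal_mult mult_ac v less_imp_le)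
qed

lemma AE_gaussian_iff:
  fixes m :: "real ^ 'n"
  assumes v: "v > 0"
  shows "(AE x in gaussian m v. P x) \<longleftrightarrow> (AE x in lborel. P x)"
  unfolding gaussian_eq_density[OF v] using v by (subst AE_density) auto

lemma AE_gaussian_norm_neq:
  fixes m a :: "real ^ 'n"
  assumes v: "v > 0"
  shows "AE x in gaussian m v. (norm (a + x))\<^sup>2 \<noteq> t"
proof -
  \<comment> \<open>For \<open>t < 0\<close> the value \<open>sqrt t\<close> is negative, so the
    sphere is empty, as is the exceptional set.\<close>
  have "emeasure lborel (sphere (- a) (sqrt t)) = 0"
    using negligible_sphere[of "- a" "sqrt t"] by (simp add: negligible_iff_emeasure0)
  then have "AE x in lborel. x \<notin> sphere (- a) (sqrt t)"
    by (intro AE_not_in) auto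
  then show ?thesis
    unfolding AE_gaussian_iff[OF v]
    by eventually_elim (auto simp: dist_norm norm_minus_commute add.commute)
qed

section \<open>The non-central chi-squared tail and its inverse\<close>

lemma chi2_tail_eq:
  fixes a :: "real ^ 'n"
  assumes "(norm a)\<^sup>2 = l"
  shows "chi2_tail TYPE('n) l t = measure (gaussian a 1) {g. t < (norm g)\<^sup>2}"
proof -
  have "chi2_tail TYPE('n) l t = measure (distr (gaussian a 1) borel (\<lambda>g. (norm g)\<^sup>2)) {t<..}"
    unfolding chi2_tail_def noncentral_chi2_eq[OF assms] ..
  also have "\<dots> = measure (gaussian a 1) {g. t < (norm g)\<^sup>2}"
    by (subst measure_distr) (auto intro!: arg_cong[where f="measure _"])
  finally show ?thesis .
qed

text \<open>With \<open>a\<close> the scaled training vector, \<open>m = 0\<close> gives the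
  false-alarm side and \<open>m = mu\<close> the power, both as tails of one family.\<close>

lemma chi2_tail_shift:
  fixes a m :: "real ^ 'n"
  assumes "(norm (a + m))\<^sup>2 = l"
  shows "chi2_tail TYPE('n) l t = measure (gaussian m 1) {g. t < (norm (a + g))\<^sup>2}"
proof -
  have "chi2_tail TYPE('n) l t = measure (distr (gaussian m 1) borel ((+) a)) {g. t < (norm g)\<^sup>2}"
    using chi2_tail_eq[OF assms] by (simp add: distr_gaussian_translation)
  also have "\<dots> = measure (gaussian m 1) {g. t < (norm (a + g))\<^sup>2}"
    by (subst measure_distr) (auto intro!: arg_cong[where f="measure _"])
  finally show ?thesis .
qed

text \<open>Acceptance region and tail both carry strict inequalities, so they are complementary
  only because the level set between them is null.\<close>

lemma chi2_tail_complement: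
  fixes a m :: "real ^ 'n"
  assumes "(norm (a + m))\<^sup>2 = l"
  shows "measure (gaussian m 1) {g. (norm (a + g))\<^sup>2 < t} = 1 - chi2_tail TYPE('n) l t"
proof -
  interpret prob_space "gaussian m 1"
    by (simp add: prob_space_gaussian)
  have "prob {g. (norm (a + g))\<^sup>2 < t} = prob {g. (norm (a + g))\<^sup>2 \<le> t}"
  proof (rule finite_measure_eq_AE)
    show "AE g in gaussian m 1. g \<in> {g. (norm (a + g))\<^sup>2 < t} \<longleftrightarrow> g \<in> {g. (norm (a + g))\<^sup>2 \<le> t}"
      using AE_gaussian_norm_neq[OF zero_less_one, where m=m and a=a and t=t] by eventually_elim auto
  qed auto
  also have "\<dots> = 1 - prob (space (gaussian m 1) - {g. (norm (a + g))\<^sup>2 \<le> t})"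
    by (subst prob_compl) auto
  also have "space (gaussian m 1) - {g. (norm (a + g))\<^sup>2 \<le> t} = {g. t < (norm (a + g))\<^sup>2}"
    by auto
  finally show ?thesis
    by (simp add: chi2_tail_shift[OF assms])
qed

lemma norm_power2_surj:
  assumes "0 \<le> l"
  obtains a :: "real ^ 'n" where "(norm a)\<^sup>2 = l"
proof -
  obtain a :: "real ^ 'n" where "norm a = sqrt l"
    using vector_choose_size[of "sqrt l"] assms by auto
  then show thesis
    using assms by (intro that[of a]) simp
qed

text \<open>The drop from \<open>s\<close> to \<open>t\<close> is at least the mass of an open shell
  \<open>U\<close>. The shell is nonempty since \<open>0 \<le> s\<close>, so it has positive
  Lebesgue measure and hence positive Gaussian measure.\<close>

lemma chi2_tail_strict_antimono:
  assumes l: "0 \<le> l" and s: "0 \<le> s" "s < t"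
  shows "chi2_tail TYPE('n::finite) l t < chi2_tail TYPE('n) l s"
proof -
  obtain a :: "real ^ 'n" where a: "(norm a)\<^sup>2 = l"
    using norm_power2_surj[OF l] .
  interpret prob_space "gaussian a 1"
    by (simp add: prob_space_gaussian)
  define U where "U = {g :: real ^ 'n. s < (norm g)\<^sup>2 \<and> (norm g)\<^sup>2 < t}"
  have "open U"
    unfolding U_def by (intro open_Collect_conj open_Collect_less continuous_intros)
  then have [measurable]: "U \<in> sets borel"
    by simp
  obtain u :: "real ^ 'n" where "(norm u)\<^sup>2 = (s + t) / 2"
    using norm_power2_surj[of "(s + t) / 2"] s by auto
  then have "u \<in> U"
    using s by (simp add: U_def)
  have "prob U \<noteq> 0"
  proof
    assume "prob U = 0"
    then have "AE g in gaussian a 1. g \<notin> U"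
      using prob_eq_0[of U] by simp
    then have "AE g in lborel. g \<notin> U"
      by (simp add: AE_gaussian_iff)
    then have "emeasure lborel U = 0"
      by (subst (asm) AE_iff_measurable[of U]) auto
    then have "negligible U"
      by (simp add: negligible_iff_emeasure0)
    then show False
      using open_not_negligible[OF \<open>open U\<close>] \<open>u \<in> U\<close> by auto
  qed
  then have "0 < prob U"
    by (simp add: zero_less_measure_iff)
  moreover have "prob U + prob {g. t < (norm g)\<^sup>2} = prob (U \<union> {g. t < (norm g)\<^sup>2})"
    by (intro finite_measure_Union[symmetric]) (auto simp: U_def)
  moreover have "\<dots> \<le> prob {g. s < (norm g)\<^sup>2}"
    using s by (intro finite_measure_mono) (auto simp: U_def)
  ultimately show ?thesis
    by (simp add: chi2_tail_eq[OF a])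
qed

lemma chi2_tail_less_iff:
  assumes "0 \<le> l" "0 \<le> s" "0 \<le> t"
  shows "chi2_tail TYPE('n::finite) l t < chi2_tail TYPE('n) l s \<longleftrightarrow> s < t"
  using chi2_tail_strict_antimono[of l s t, where 'n='n] chi2_tail_strict_antimono[of l t s, where 'n='n]
    assms by (cases s t rule: linorder_cases) auto

text \<open>The intermediate value theorem applies to the distribution function of the squared norm:
  it vanishes at 0, tends to 1, and is continuous because there are no atoms.\<close>

lemma chi2_tail_attains:
  assumes l: "0 \<le> l" and p: "0 < p" "p < 1"
  obtains t where "0 \<le> t" "chi2_tail TYPE('n::finite) l t = p"
proof -
  obtain a :: "real ^ 'n" where a: "(norm a)\<^sup>2 = l"
    using norm_power2_surj[OF l] .
  interpret G: prob_space "gaussian a 1"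
    by (simp add: prob_space_gaussian)
  define D where "D = distr (gaussian a 1) borel (\<lambda>g. (norm g)\<^sup>2)"
  interpret real_distribution D
    unfolding D_def by (intro real_distribution.intro real_distribution_axioms.intro G.prob_space_distr) auto
  have atom: "measure D {t} = 0" for t
  proof -
    have "measure D {t} = measure (gaussian a 1) {g. (norm g)\<^sup>2 = t}"
      unfolding D_def by (subst measure_distr) (auto intro!: arg_cong[where f="measure _"])
    also have "\<dots> = 0"
      using AE_gaussian_norm_neq[OF zero_less_one, where m=a and a=0 and t=t] by (subst G.prob_eq_0) auto
    finally show ?thesis .
  qed
  have tail: "chi2_tail TYPE('n) l t = 1 - cdf D t" for t
  proof -
    have "prob {t<..} = 1 - prob {..t}"
      using prob_compl[of "{..t}"] by (simp add: Compl_eq_Diff_UNIV[symmetric] del: Compl_eq_Diff_UNIV)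
    then show ?thesis
      unfolding chi2_tail_def noncentral_chi2_eq[OF a] D_def[symmetric] cdf_def .
  qed
  have "cdf D 0 = 0"
  proof -
    have "cdf D 0 = measure (gaussian a 1) {g. (norm g)\<^sup>2 \<le> 0}"
      unfolding D_def cdf_def by (subst measure_distr) (auto intro!: arg_cong[where f="measure _"])
    also have "\<dots> = 0"
      using AE_gaussian_norm_neq[OF zero_less_one, where m=a and a=0 and t=0] by (subst G.prob_eq_0) auto
    finally show ?thesis .
  qed
  moreover have "eventually (\<lambda>t. cdf D t > 1 - p \<and> 0 \<le> t) at_top"
    using p by (intro eventually_conj order_tendstoD(1)[OF cdf_lim_at_top_prob] eventually_ge_at_top) auto
  then obtain b where "cdf D b > 1 - p" "0 \<le> b"
    by (auto simp: eventually_at_top_linorder)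
  moreover have "continuous_on {0..b} (cdf D)"
    using atom by (intro continuous_at_imp_continuous_on) (auto simp: isCont_cdf)
  ultimately obtain t where "0 \<le> t" "cdf D t = 1 - p"
    using IVT'[of "cdf D" 0 "1 - p" b] p by auto
  then show thesis
    by (intro that[of t]) (auto simp: tail)
qed

lemma
  assumes l: "0 \<le> l" and p: "0 < p" "p < 1"
  shows chi2_tail_inv_nonneg: "0 \<le> chi2_tail_inv TYPE('n::finite) l p"
    and chi2_tail_tail_inv: "chi2_tail TYPE('n) l (chi2_tail_inv TYPE('n) l p) = p"
proof -
  have inj: "inj_on (chi2_tail TYPE('n) l) {0..}"
    using chi2_tail_less_iff[OF l, where 'n='n]
    by (intro inj_onI) (metis atLeast_iff linorder_neq_iff)
  obtain t where "0 \<le> t" "chi2_tail TYPE('n) l t = p"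
    using chi2_tail_attains[OF l p] .
  then have p_img: "p \<in> chi2_tail TYPE('n) l ` {0..}"
    by auto
  show "0 \<le> chi2_tail_inv TYPE('n::finite) l p"
    using the_inv_into_into[OF inj p_img subset_refl] by (simp add: chi2_tail_inv_def)
  show "chi2_tail TYPE('n) l (chi2_tail_inv TYPE('n) l p) = p"
    using f_the_inv_into_f[OF inj p_img] by (simp add: chi2_tail_inv_def)
qed

text \<open>Applying the strictly decreasing tail to both sides eliminates the inverse and reverses
  the order.\<close>

lemma less_chi2_tail_inv_iff:
  assumes "0 \<le> l" "0 < p" "p < 1" "0 \<le> s"
  shows "s < chi2_tail_inv TYPE('n::finite) l p \<longleftrightarrow> p < chi2_tail TYPE('n) l s"
  using chi2_tail_less_iff[of l s "chi2_tail_inv TYPE('n) l p", where 'n='n] assms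
  by (simp add: chi2_tail_inv_nonneg chi2_tail_tail_inv)

section \<open>The discriminant rule\<close>

definition accepts :: "real \<Rightarrow> real \<Rightarrow> real ^ 'n \<Rightarrow> real ^ 'n \<Rightarrow> bool" where
  "accepts rho p x y \<longleftrightarrow>
     (norm (rho *\<^sub>R x + y))\<^sup>2 < chi2_tail_inv TYPE('n) ((norm (rho *\<^sub>R x))\<^sup>2) p"

text \<open>The threshold is defined through an inverse, so its measurability in \<open>x\<close> is
  not evident. Instead, acceptance is rewritten as \<open>p\<close> lying below a Gaussian integral
  with parameters \<open>x\<close> and \<open>y\<close>, and such integrals are measurable in their
  parameters.\<close>

lemma measurable_accepts:
  assumes p: "0 < p" "p < 1"
  shows "Measurable.pred (borel \<Otimes>\<^sub>M borel) (\<lambda>(x, y). accepts rho p x (y :: real ^ 'n))"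
proof -
  interpret prob_space "gaussian (0 :: real ^ 'n) 1"
    by (simp add: prob_space_gaussian)
  have "accepts rho p x y \<longleftrightarrow>
      p < (\<integral>g. indicator {g. (norm (rho *\<^sub>R x + y))\<^sup>2 < (norm (rho *\<^sub>R x + g))\<^sup>2} g \<partial>gaussian 0 1)"
    for x y :: "real ^ 'n"
    unfolding accepts_def using p
    by (subst less_chi2_tail_inv_iff) (auto simp: chi2_tail_shift[of "rho *\<^sub>R x" 0])
  then have "(\<lambda>(x, y :: real ^ 'n). accepts rho p x y) = (\<lambda>w. p < (\<integral>g. indicator
      {w. (norm (rho *\<^sub>R fst (fst w) + snd (fst w)))\<^sup>2 < (norm (rho *\<^sub>R fst (fst w) + snd w))\<^sup>2} (w, g)
        \<partial>gaussian 0 1))"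
    by (auto simp: fun_eq_iff indicator_def)
  also have "Measurable.pred (borel \<Otimes>\<^sub>M borel) \<dots>"
    by measurable
  finally show ?thesis .
qed

lemma discriminant_rule_eq: "discriminant_rule rho p x y = return decision_space (\<not> accepts rho p x y)"
  by (simp add: discriminant_rule_def accepts_def)

lemma discriminant_rule_in_detectors:
  assumes "0 < p" "p < 1"
  shows "(discriminant_rule rho p :: 'n::finite detector) \<in> detectors"
proof -
  note [measurable] = measurable_accepts[OF assms, of rho, where 'n='n]
  have "(\<lambda>w. return decision_space (\<not> (case w of (x, y :: real ^ 'n) \<Rightarrow> accepts rho p x y))) \<in>
      borel \<Otimes>\<^sub>M borel \<rightarrow>\<^sub>M prob_algebra decision_space"
    by (rule measurable_compose[OF _ measurable_return_prob_space]) measurable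
  then show ?thesis
    by (simp add: detectors_def discriminant_rule_eq split_def)
qed

section \<open>Error probabilities as integrals of the acceptance probability\<close>

text \<open>For a detector this is one minus the critical function of the randomized test. Values in
  \<open>ennreal\<close> make Tonelli available without integrability conditions.\<close>

definition acceptance :: "'n::finite detector \<Rightarrow> (real ^ 'n) \<times> (real ^ 'n) \<Rightarrow> ennreal" where
  "acceptance R w = emeasure (R (fst w) (snd w)) {False}"

lemma measurable_acceptance:
  assumes "R \<in> detectors"
  shows "acceptance R \<in> borel_measurable (borel \<Otimes>\<^sub>M borel)"
proof -
  have "(\<lambda>w. R (fst w) (snd w)) \<in> borel \<Otimes>\<^sub>M borel \<rightarrow>\<^sub>M subprob_algebra decision_space"
    using assms by (intro measurable_prob_algebraD) (simp add: detectors_def split_def)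
  then show ?thesis
    unfolding acceptance_def by (rule measurable_compose[OF _ measurable_emeasure_subprob_algebra]) simp
qed

lemma measurable_detector:
  assumes "R \<in> detectors"
  shows "R x \<in> borel \<rightarrow>\<^sub>M prob_algebra decision_space"
proof -
  have "Pair x \<in> borel \<rightarrow>\<^sub>M borel \<Otimes>\<^sub>M borel"
    by simp
  moreover have "(\<lambda>(x, y). R x y) \<in> borel \<Otimes>\<^sub>M borel \<rightarrow>\<^sub>M prob_algebra decision_space"
    using assms by (simp add: detectors_def)
  ultimately have "(\<lambda>y. (\<lambda>(x, y). R x y) (x, y)) \<in> borel \<rightarrow>\<^sub>M prob_algebra decision_space"
    by (rule measurable_compose)
  then show ?thesis
    by simp
qed

lemma prob_space_decision:
  assumes "R \<in> detectors"
  shows "prob_space (R x y)" "sets (R x y) = UNIV" "space (R x y) = UNIV"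
proof -
  have R: "prob_space (R x y)" "sets (R x y) = sets decision_space"
    using measurable_space[OF measurable_detector[OF assms], of y x] by (auto simp: space_prob_algebra)
  then show "prob_space (R x y)" "sets (R x y) = UNIV" "space (R x y) = UNIV"
    using sets_eq_imp_space_eq[OF R(2)] by auto
qed

lemma acceptance_add_rejection:
  assumes "R \<in> detectors"
  shows "acceptance R (x, y) + emeasure (R x y) {True} = 1"
proof -
  have "emeasure (R x y) {False} + emeasure (R x y) {True} = emeasure (R x y) ({False} \<union> {True})"
    using prob_space_decision[OF assms] by (intro plus_emeasure) auto
  also have "{False} \<union> {True} = space (R x y)"
    using prob_space_decision[OF assms] by auto
  finally show ?thesis
    using prob_space_decision(1)[OF assms] by (simp add: acceptance_def prob_space.emeasure_space_1)
qed

lemma acceptance_discriminant_rule: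
  "acceptance (discriminant_rule rho p) (x, y) = indicator {y. accepts rho p x y} y"
  by (simp add: acceptance_def discriminant_rule_eq indicator_def)

lemma gaussian_in_prob_algebra:
  "v > 0 \<Longrightarrow> gaussian m v \<in> space (prob_algebra borel)"
  by (simp add: space_prob_algebra prob_space_gaussian)

text \<open>Translates the level constraint into a lower bound on the null integral of the
  acceptance probability.\<close>

lemma one_minus_p_fa:
  fixes R :: "'n::finite detector"
  assumes R: "R \<in> detectors"
  shows "(\<integral>\<^sup>+y. acceptance R (x, y) \<partial>gaussian 0 1) = ennreal (1 - p_fa R x)"
proof -
  have N: "gaussian (0 :: real ^ 'n) 1 \<in> space (prob_algebra borel)"
    by (simp add: gaussian_in_prob_algebra)
  interpret B: prob_space "gaussian 0 1 \<bind> R x"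
    by (rule prob_space_bind'[OF N measurable_detector[OF R]])
  have "(\<integral>\<^sup>+y. acceptance R (x, y) \<partial>gaussian 0 1) = emeasure (gaussian 0 1 \<bind> R x) {False}"
    unfolding acceptance_def fst_conv snd_conv
    by (rule emeasure_bind_prob_algebra[OF N measurable_detector[OF R], symmetric]) simp
  also have "\<dots> = ennreal (1 - p_fa R x)"
  proof -
    have sets: "sets (gaussian 0 1 \<bind> R x) = sets decision_space"
      by (rule sets_bind'[OF N measurable_detector[OF R]])
    then have sp: "sets (gaussian 0 1 \<bind> R x) = UNIV" "space (gaussian 0 1 \<bind> R x) = UNIV"
      using sets_eq_imp_space_eq[OF sets] by auto
    have "{False} = space (gaussian 0 1 \<bind> R x) - {True}"
      unfolding sp by auto
    then have "B.prob {False} = 1 - B.prob {True}"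
      using B.prob_compl[of "{True}"] by (simp add: sp(1))
    then show ?thesis
      by (simp add: B.emeasure_eq_measure p_fa_def)
  qed
  finally show ?thesis .
qed

text \<open>The mass of a bind is the integral of the kernel; independence of \<open>X\<close> and
  \<open>Y\<close> then turns it into an iterated integral.\<close>

lemma p_md_eq_nn_integral:
  fixes R :: "'n::finite detector"
  assumes R: "R \<in> detectors" and rho: "rho > 0"
  shows "ennreal (p_md rho R mu) =
    (\<integral>\<^sup>+x. \<integral>\<^sup>+y. acceptance R (x, y) \<partial>gaussian mu 1 \<partial>gaussian mu (1 / rho))"
proof -
  interpret N: prob_space "gaussian mu 1"
    by (simp add: prob_space_gaussian)
  interpret M: prob_space "gaussian mu (1 / rho)"
    using rho by (simp add: prob_space_gaussian)
  interpret P: pair_prob_space "gaussian mu (1 / rho)" "gaussian mu 1" ..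
  let ?P = "gaussian mu (1 / rho) \<Otimes>\<^sub>M gaussian mu 1"
  note [measurable] = measurable_acceptance[OF R]
  have P: "?P \<in> space (prob_algebra (borel \<Otimes>\<^sub>M borel))"
    using P.prob_space_axioms sets_pair_measure_cong[OF sets_gaussian[of mu "1 / rho"] sets_gaussian[of mu 1]]
    by (simp add: space_prob_algebra)
  have Rm: "(\<lambda>(x, y). R x y) \<in> borel \<Otimes>\<^sub>M borel \<rightarrow>\<^sub>M prob_algebra decision_space"
    using R by (simp add: detectors_def)
  interpret B: prob_space "?P \<bind> (\<lambda>(x, y). R x y)"
    by (rule prob_space_bind'[OF P Rm])
  have "ennreal (p_md rho R mu) = (\<integral>\<^sup>+w. acceptance R w \<partial>?P)"
    unfolding p_md_def B.emeasure_eq_measure[symmetric]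
    by (subst emeasure_bind_prob_algebra[OF P Rm]) (auto simp: acceptance_def[abs_def] split_def)
  also have "\<dots> = (\<integral>\<^sup>+x. \<integral>\<^sup>+y. acceptance R (x, y) \<partial>gaussian mu 1 \<partial>gaussian mu (1 / rho))"
    by (intro N.nn_integral_fst[symmetric]) measurable
  finally show ?thesis .
qed

text \<open>Keeps the suprema over minimax sets bounded above.\<close>

lemma p_md_le_1:
  fixes R :: "'n::finite detector"
  assumes R: "R \<in> detectors" and rho: "rho > 0"
  shows "p_md rho R mu \<le> 1"
proof -
  interpret N: prob_space "gaussian mu 1"
    by (simp add: prob_space_gaussian)
  interpret M: prob_space "gaussian mu (1 / rho)"
    using rho by (simp add: prob_space_gaussian)
  have "acceptance R (x, y) \<le> 1" for x y
    using acceptance_add_rejection[OF R, of x y] by (metis le_iff_add)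
  then have "ennreal (p_md rho R mu) \<le> (\<integral>\<^sup>+x. \<integral>\<^sup>+y. 1 \<partial>gaussian mu 1 \<partial>gaussian mu (1 / rho))"
    unfolding p_md_eq_nn_integral[OF R rho] by (intro nn_integral_mono)
  also have "\<dots> = 1"
    by (simp add: N.emeasure_space_1[simplified] M.emeasure_space_1[simplified])
  finally show ?thesis
    by simp
qed

section \<open>Error probabilities of the discriminant rule\<close>

lemma measure_accepts:
  fixes x mu :: "real ^ 'n"
  shows "measure (gaussian mu 1) {y. accepts rho p x y} =
    1 - chi2_tail TYPE('n) ((norm (rho *\<^sub>R x + mu))\<^sup>2) (chi2_tail_inv TYPE('n) ((norm (rho *\<^sub>R x))\<^sup>2) p)"
  unfolding accepts_def by (rule chi2_tail_complement) simp

lemma nn_integral_acceptance_discriminant_rule: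
  fixes x mu :: "real ^ 'n"
  shows "(\<integral>\<^sup>+y. acceptance (discriminant_rule rho p) (x, y) \<partial>gaussian mu 1) =
    ennreal (1 - chi2_tail TYPE('n) ((norm (rho *\<^sub>R x + mu))\<^sup>2) (chi2_tail_inv TYPE('n) ((norm (rho *\<^sub>R x))\<^sup>2) p))"
proof -
  interpret N: prob_space "gaussian mu 1"
    by (simp add: prob_space_gaussian)
  have "{y. accepts rho p x y} \<in> sets borel"
    unfolding accepts_def by measurable
  then show ?thesis
    by (simp add: acceptance_discriminant_rule N.emeasure_eq_measure measure_accepts)
qed

text \<open>For mean 0 the two non-centrality parameters coincide, so the tail is evaluated at its
  own inverse.\<close>

lemma p_fa_discriminant_rule:
  assumes "0 < p" "p < 1"
  shows "p_fa (discriminant_rule rho p :: 'n::finite detector) x = p"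
proof -
  let ?R = "discriminant_rule rho p :: 'n detector"
  have R: "?R \<in> detectors"
    using assms by (rule discriminant_rule_in_detectors)
  interpret prob_space "gaussian 0 1 \<bind> ?R x"
    by (rule prob_space_bind'[OF gaussian_in_prob_algebra[OF zero_less_one] measurable_detector[OF R]])
  \<comment> \<open>Makes \<open>1 - p_fa ?R x\<close> nonnegative, so that the coercion to
    \<open>ennreal\<close> can be cancelled.\<close>
  have "p_fa ?R x \<le> 1"
    by (simp add: p_fa_def)
  moreover have "ennreal (1 - p_fa ?R x) = ennreal (1 - p)"
    unfolding one_minus_p_fa[OF R, symmetric] nn_integral_acceptance_discriminant_rule
    using assms by (simp add: chi2_tail_tail_inv)
  ultimately show ?thesis
    using assms by simp
qed

text \<open>Given \<open>X = x\<close>, the rule misses with probability \<open>1 - q mu x\<close>;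
  integrating over \<open>x\<close> gives the formula. Since \<open>q\<close> sees only norms,
  rotating \<open>mu\<close> and \<open>x\<close> together leaves it unchanged, and the law of
  \<open>X\<close> rotates along with its mean.\<close>

lemma
  fixes mu :: "real ^ 'n" and f :: "real ^ 'n \<Rightarrow> real ^ 'n"
  assumes rho: "rho > 0" and p: "0 < p" "p < 1"
  defines "q \<equiv> \<lambda>mu x. chi2_tail TYPE('n) ((norm (rho *\<^sub>R x + mu))\<^sup>2)
    (chi2_tail_inv TYPE('n) ((norm (rho *\<^sub>R x))\<^sup>2) p)"
  shows p_md_discriminant_rule:
      "p_md rho (discriminant_rule rho p) mu = 1 - (\<integral>x. q mu x \<partial>gaussian mu (1 / rho))"
    and p_md_discriminant_rule_orthogonal:
      "orthogonal_transformation f \<Longrightarrow>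
        p_md rho (discriminant_rule rho p) (f mu) = p_md rho (discriminant_rule rho p) mu"
proof -
  have R: "(discriminant_rule rho p :: 'n detector) \<in> detectors"
    using p by (rule discriminant_rule_in_detectors)
  note [measurable] = measurable_acceptance[OF R]
  have q_eq: "1 - q mu x = measure (gaussian mu 1) {y. accepts rho p x y}" for mu x
    unfolding measure_accepts q_def ..
  have q01: "0 \<le> 1 - q mu x" "0 \<le> q mu x" for mu x
    unfolding q_eq by (auto simp: q_def chi2_tail_def)
  \<comment> \<open>Recovered from the partial integral of the acceptance probability;
    \<open>enn2real\<close> undoes the coercion because \<open>1 - q mu x\<close> is
    nonnegative.\<close>
  have q_meas [measurable]: "q mu \<in> borel_measurable borel" for mu
  proof -
    interpret N: prob_space "gaussian mu 1"
      by (simp add: prob_space_gaussian)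
    have "(\<lambda>x. \<integral>\<^sup>+y. acceptance (discriminant_rule rho p) (x, y) \<partial>gaussian mu 1) \<in> borel_measurable borel"
      by measurable
    then have "(\<lambda>x. enn2real (ennreal (1 - q mu x))) \<in> borel_measurable borel"
      unfolding nn_integral_acceptance_discriminant_rule q_def by measurable
    then have "(\<lambda>x. 1 - q mu x) \<in> borel_measurable borel"
      using q01 by simp
    from borel_measurable_diff[OF borel_measurable_const[of 1] this] show ?thesis
      by simp
  qed
  have eq: "p_md rho (discriminant_rule rho p) mu = 1 - (\<integral>x. q mu x \<partial>gaussian mu (1 / rho))" for mu
  proof -
    interpret M: prob_space "gaussian mu (1 / rho)"
      using rho by (simp add: prob_space_gaussian)
    have "ennreal (p_md rho (discriminant_rule rho p) mu) = (\<integral>\<^sup>+x. ennreal (1 - q mu x) \<partial>gaussian mu (1 / rho))"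
      unfolding p_md_eq_nn_integral[OF R rho] nn_integral_acceptance_discriminant_rule q_def ..
    then have "(\<integral>x. 1 - q mu x \<partial>gaussian mu (1 / rho)) = enn2real (ennreal (p_md rho (discriminant_rule rho p) mu))"
      using q01 by (subst integral_eq_nn_integral) auto
    then have "p_md rho (discriminant_rule rho p) mu = (\<integral>x. 1 - q mu x \<partial>gaussian mu (1 / rho))"
      by (simp add: p_md_def)
    also have "\<dots> = 1 - (\<integral>x. q mu x \<partial>gaussian mu (1 / rho))"
    proof (subst Bochner_Integration.integral_diff)
      have "\<bar>q mu x\<bar> \<le> 1" for x
        using q01[of mu x] by simp
      then show "integrable (gaussian mu (1 / rho)) (q mu)"
        by (intro M.integrable_const_bound[of _ 1]) auto
    qed (simp_all add: M.prob_space[simplified])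
    finally show ?thesis .
  qed
  then show "p_md rho (discriminant_rule rho p) mu = 1 - (\<integral>x. q mu x \<partial>gaussian mu (1 / rho))" .
  show "p_md rho (discriminant_rule rho p) (f mu) = p_md rho (discriminant_rule rho p) mu"
    if f: "orthogonal_transformation f"
  proof -
    have [measurable]: "f \<in> borel_measurable borel"
      using f by (rule measurable_orthogonal_transformation)
    have nrm: "norm (f x) = norm x" for x
      using f by (simp add: orthogonal_transformation_norm)
    have "rho *\<^sub>R f x + f mu = f (rho *\<^sub>R x + mu)" "rho *\<^sub>R f x = f (rho *\<^sub>R x)" for x
      using orthogonal_transformation_linear[OF f] by (simp_all add: linear_add linear_scale)
    then have "q (f mu) (f x) = q mu x" for x
      by (simp add: q_def nrm)
    moreover have "(\<integral>x. q (f mu) x \<partial>gaussian (f mu) (1 / rho)) = (\<integral>x. q (f mu) (f x) \<partial>gaussian mu (1 / rho))"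
      using rho by (subst distr_gaussian_orthogonal[OF f, symmetric]) (auto intro: integral_distr)
    ultimately show ?thesis
      by (simp add: eq)
  qed
qed

section \<open>Averaging over a sphere\<close>

text \<open>The normalised standard Gaussian vector is uniform on the unit sphere, so this is the moment
  generating function of the uniform law on the sphere of radius \<open>d\<close>.\<close>

definition sphere_mgf :: "real \<Rightarrow> real ^ 'n \<Rightarrow> ennreal" where
  "sphere_mgf d z = (\<integral>\<^sup>+g. ennreal (exp (d * (z \<bullet> sgn g))) \<partial>gaussian 0 1)"

lemma measurable_sgn_vec [measurable]: "(sgn :: real ^ 'n \<Rightarrow> real ^ 'n) \<in> borel_measurable borel"
  unfolding sgn_div_norm by measurable

lemma measurable_sphere_mgf [measurable]: "sphere_mgf d \<in> borel_measurable borel"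
proof -
  interpret prob_space "gaussian (0 :: real ^ 'n) 1"
    by (simp add: prob_space_gaussian)
  show ?thesis
    unfolding sphere_mgf_def by measurable
qed

text \<open>Cauchy-Schwarz bounds the exponent uniformly in \<open>g\<close>. Finiteness allows the
  cancellation that closes the Neyman-Pearson argument.\<close>

lemma sphere_mgf_finite: "sphere_mgf d (z :: real ^ 'n) < \<infinity>"
proof -
  interpret prob_space "gaussian (0 :: real ^ 'n) 1"
    by (simp add: prob_space_gaussian)
  have "d * (z \<bullet> sgn g) \<le> \<bar>d\<bar> * norm z" for g
  proof -
    have "\<bar>z \<bullet> sgn g\<bar> \<le> norm z * norm (sgn g)"
      by (rule Cauchy_Schwarz_ineq2)
    also have "\<dots> \<le> norm z"
      by (simp add: norm_sgn)
    finally have "\<bar>d * (z \<bullet> sgn g)\<bar> \<le> \<bar>d\<bar> * norm z"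
      by (simp add: abs_mult mult_left_mono)
    then show ?thesis
      by linarith
  qed
  then have "sphere_mgf d z \<le> (\<integral>\<^sup>+g. ennreal (exp (\<bar>d\<bar> * norm z)) \<partial>gaussian (0 :: real ^ 'n) 1)"
    unfolding sphere_mgf_def by (intro nn_integral_mono ennreal_leI) simp
  also have "\<dots> < \<infinity>"
    by (simp add: emeasure_space_1[simplified])
  finally show ?thesis .
qed

text \<open>The standard Gaussian is invariant under \<open>f\<close>, and \<open>f\<close> commutes
  with \<open>sgn\<close>; substituting \<open>f g\<close> for \<open>g\<close> makes
  \<open>f\<close> disappear from the inner product.\<close>

lemma sphere_mgf_orthogonal:
  fixes f :: "real ^ 'n \<Rightarrow> real ^ 'n"
  assumes f: "orthogonal_transformation f"
  shows "sphere_mgf d (f z) = sphere_mgf d z"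
proof -
  have [measurable]: "f \<in> borel_measurable borel"
    using f by (rule measurable_orthogonal_transformation)
  have "gaussian 0 1 = distr (gaussian 0 1) borel f"
    using f by (simp add: distr_gaussian_orthogonal linear_0 orthogonal_transformation_linear)
  then have "sphere_mgf d (f z) = (\<integral>\<^sup>+g. ennreal (exp (d * (f z \<bullet> sgn g))) \<partial>distr (gaussian 0 1) borel f)"
    by (simp add: sphere_mgf_def)
  also have "\<dots> = (\<integral>\<^sup>+g. ennreal (exp (d * (f z \<bullet> sgn (f g)))) \<partial>gaussian 0 1)"
    by (rule nn_integral_distr) auto
  also have "\<dots> = sphere_mgf d z"
  proof -
    have "f z \<bullet> sgn (f g) = z \<bullet> sgn g" for g
      using f by (simp add: sgn_div_norm orthogonal_transformation_norm orthogonal_transformation_def)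
    then show ?thesis
      by (simp add: sphere_mgf_def)
  qed
  finally show ?thesis .
qed

text \<open>By the symmetry \<open>g \<mapsto> - g\<close> the exponential may be replaced by the hyperbolic cosine.\<close>

lemma sphere_mgf_mono:
  fixes z w :: "real ^ 'n"
  assumes "norm z \<le> norm w"
  shows "sphere_mgf d z \<le> sphere_mgf d w"
proof -
  have even: "sphere_mgf d u + sphere_mgf d u = (\<integral>\<^sup>+g. ennreal (2 * cosh (d * (u \<bullet> sgn g))) \<partial>gaussian 0 1)"
    for u :: "real ^ 'n"
  proof -
    have "sphere_mgf d u + sphere_mgf d u = sphere_mgf d u + sphere_mgf d (- u)"
      using sphere_mgf_orthogonal[of uminus d u] by (simp add: orthogonal_transformation_neg)
    also have "\<dots> = (\<integral>\<^sup>+g. ennreal (exp (d * (u \<bullet> sgn g))) + ennreal (exp (d * (- u \<bullet> sgn g))) \<partial>gaussian 0 1)"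
      unfolding sphere_mgf_def by (subst nn_integral_add) auto
    also have "\<dots> = (\<integral>\<^sup>+g. ennreal (2 * cosh (d * (u \<bullet> sgn g))) \<partial>gaussian 0 1)"
      by (intro nn_integral_cong) (simp add: cosh_field_def ennreal_plus[symmetric] del: ennreal_plus)
    finally show ?thesis .
  qed
  \<comment> \<open>By rotation invariance \<open>z\<close> may be replaced by the vector of the
    same norm on the ray of \<open>w\<close>. This shrinks the argument of the even function
    \<open>cosh\<close> for every \<open>g\<close>. If \<open>w = 0\<close> then also
    \<open>z = 0\<close>, and \<open>c = 0\<close> serves.\<close>
  define c where "c = (if w = 0 then 0 else norm z / norm w)"
  have c: "0 \<le> c" "c \<le> 1" "norm z = norm (c *\<^sub>R w)"
    using assms by (auto simp: c_def divide_le_eq)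
  from c(3) obtain f where f: "orthogonal_transformation f" "f z = c *\<^sub>R w"
    using orthogonal_transformation_exists by blast
  have "cosh (d * (c *\<^sub>R w \<bullet> sgn g)) \<le> cosh (d * (w \<bullet> sgn g))" for g
  proof -
    have "\<bar>d * (c *\<^sub>R w \<bullet> sgn g)\<bar> = c * \<bar>d * (w \<bullet> sgn g)\<bar>"
      using c by (simp add: abs_mult)
    also have "\<dots> \<le> \<bar>d * (w \<bullet> sgn g)\<bar>"
      using c by (simp add: mult_left_le_one_le)
    finally have "cosh \<bar>d * (c *\<^sub>R w \<bullet> sgn g)\<bar> \<le> cosh \<bar>d * (w \<bullet> sgn g)\<bar>"
      by (subst cosh_real_nonneg_le_iff) auto
    then show ?thesis
      by (simp only: cosh_real_abs)
  qed
  then have "sphere_mgf d (c *\<^sub>R w) + sphere_mgf d (c *\<^sub>R w) \<le> sphere_mgf d w + sphere_mgf d w"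
    unfolding even by (intro nn_integral_mono ennreal_leI) simp
  then have "2 * sphere_mgf d (c *\<^sub>R w) \<le> 2 * sphere_mgf d w"
    by (simp add: mult_2)
  then have "sphere_mgf d (c *\<^sub>R w) \<le> sphere_mgf d w"
    by (subst (asm) ennreal_mult_le_mult_iff) auto
  then show ?thesis
    using sphere_mgf_orthogonal[OF f(1), of d z] f(2) by simp
qed

section \<open>Change of measure and the average over directions\<close>

text \<open>Both Gaussians are tilted to mean 0. The two exponents add up, with weight
  \<open>rho\<close> on the training part, so \<open>mu\<close> meets the data only through
  \<open>rho *\<^sub>R x + y\<close>; this is where the statistic of the rule comes from.\<close>

lemma p_md_tilt:
  fixes R :: "'n::finite detector"
  assumes R: "R \<in> detectors" and rho: "rho > 0"
  shows "ennreal (p_md rho R mu) =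
    (\<integral>\<^sup>+x. \<integral>\<^sup>+y. acceptance R (x, y) *
      ennreal (exp ((rho *\<^sub>R x + y) \<bullet> mu - (rho + 1) * (norm mu)\<^sup>2 / 2)) \<partial>gaussian 0 1 \<partial>gaussian 0 (1 / rho))"
proof -
  interpret N: prob_space "gaussian (0 :: real ^ 'n) 1"
    by (simp add: prob_space_gaussian)
  note [measurable] = measurable_acceptance[OF R]
  have "ennreal (p_md rho R mu) =
    (\<integral>\<^sup>+x. ennreal (exp ((x \<bullet> mu) / (1 / rho) - (norm mu)\<^sup>2 / (2 * (1 / rho)))) *
      (\<integral>\<^sup>+y. ennreal (exp ((y \<bullet> mu) / 1 - (norm mu)\<^sup>2 / (2 * 1))) * acceptance R (x, y) \<partial>gaussian 0 1)
      \<partial>gaussian 0 (1 / rho))"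
    unfolding p_md_eq_nn_integral[OF R rho]
    using rho by (subst (1 2) gaussian_tilt) (simp_all add: nn_integral_density)
  also have "\<dots> = (\<integral>\<^sup>+x. \<integral>\<^sup>+y. acceptance R (x, y) *
      ennreal (exp ((rho *\<^sub>R x + y) \<bullet> mu - (rho + 1) * (norm mu)\<^sup>2 / 2)) \<partial>gaussian 0 1 \<partial>gaussian 0 (1 / rho))"
  proof (intro nn_integral_cong)
    fix x :: "real ^ 'n"
    have "exp ((rho *\<^sub>R x + y) \<bullet> mu - (rho + 1) * (norm mu)\<^sup>2 / 2) =
        exp ((x \<bullet> mu) / (1 / rho) - (norm mu)\<^sup>2 / (2 * (1 / rho))) * exp ((y \<bullet> mu) / 1 - (norm mu)\<^sup>2 / (2 * 1))"
      for y
      using rho by (simp add: inner_add_left field_simps flip: exp_add)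
    then show "ennreal (exp ((x \<bullet> mu) / (1 / rho) - (norm mu)\<^sup>2 / (2 * (1 / rho)))) *
        (\<integral>\<^sup>+y. ennreal (exp ((y \<bullet> mu) / 1 - (norm mu)\<^sup>2 / (2 * 1))) * acceptance R (x, y) \<partial>gaussian 0 1) =
      (\<integral>\<^sup>+y. acceptance R (x, y) *
        ennreal (exp ((rho *\<^sub>R x + y) \<bullet> mu - (rho + 1) * (norm mu)\<^sup>2 / 2)) \<partial>gaussian 0 1)"
      by (subst nn_integral_cmult[symmetric]) (simp_all add: ennreal_mult mult_ac)
  qed
  finally show ?thesis .
qed

text \<open>Only \<open>g = 0\<close>, where \<open>sgn\<close> vanishes, can fail, and it is a null
  set.\<close>

lemma AE_norm_sgn_gaussian:
  assumes "0 \<le> d"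
  shows "AE g in gaussian (0 :: real ^ 'n) 1. norm (d *\<^sub>R sgn g) = d"
  using AE_gaussian_norm_neq[OF zero_less_one, where m="0 :: real ^ 'n" and a=0 and t=0]
  by eventually_elim (use assms in \<open>simp add: norm_sgn\<close>)

text \<open>Tonelli moves the average over directions innermost, where it meets only the exponential
  and turns it into \<open>sphere_mgf\<close>.\<close>

lemma p_md_sphere_average:
  fixes R :: "'n::finite detector"
  assumes R: "R \<in> detectors" and rho: "rho > 0" and d: "0 \<le> d"
  shows "(\<integral>\<^sup>+g. ennreal (p_md rho R (d *\<^sub>R sgn g)) \<partial>gaussian 0 1) =
    (\<integral>\<^sup>+x. ennreal (exp (- (rho + 1) * d\<^sup>2 / 2)) *
      (\<integral>\<^sup>+y. acceptance R (x, y) * sphere_mgf d (rho *\<^sub>R x + y) \<partial>gaussian 0 1) \<partial>gaussian 0 (1 / rho))"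
proof -
  interpret N: prob_space "gaussian (0 :: real ^ 'n) 1"
    by (simp add: prob_space_gaussian)
  interpret M: prob_space "gaussian (0 :: real ^ 'n) (1 / rho)"
    using rho by (simp add: prob_space_gaussian)
  interpret NM: pair_sigma_finite "gaussian (0 :: real ^ 'n) 1" "gaussian (0 :: real ^ 'n) (1 / rho)" ..
  interpret NN: pair_sigma_finite "gaussian (0 :: real ^ 'n) 1" "gaussian (0 :: real ^ 'n) 1" ..
  note [measurable] = measurable_acceptance[OF R]
  \<comment> \<open>The part of the tilt that is constant on the sphere of radius
    \<open>d\<close>.\<close>
  define C where "C = ennreal (exp (- (rho + 1) * d\<^sup>2 / 2))"
  define F where "F g x y = C * (acceptance R (x, y) * ennreal (exp (d * ((rho *\<^sub>R x + y) \<bullet> sgn g))))"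
    for g x y
  have "(\<integral>\<^sup>+g. ennreal (p_md rho R (d *\<^sub>R sgn g)) \<partial>gaussian 0 1) =
      (\<integral>\<^sup>+g. \<integral>\<^sup>+x. \<integral>\<^sup>+y. F g x y \<partial>gaussian 0 1 \<partial>gaussian 0 (1 / rho) \<partial>gaussian 0 1)"
  proof (rule nn_integral_cong_AE)
    show "AE g in gaussian 0 1. ennreal (p_md rho R (d *\<^sub>R sgn g)) =
        (\<integral>\<^sup>+x. \<integral>\<^sup>+y. F g x y \<partial>gaussian 0 1 \<partial>gaussian 0 (1 / rho))"
      using AE_norm_sgn_gaussian[OF d]
    proof eventually_elim
      case (elim g)
      have eq: "exp (z \<bullet> (d *\<^sub>R sgn g) - (rho + 1) * (norm (d *\<^sub>R sgn g))\<^sup>2 / 2) =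
          exp (- (rho + 1) * d\<^sup>2 / 2) * exp (d * (z \<bullet> sgn g))" for z :: "real ^ 'n"
        unfolding elim exp_add[symmetric] by (rule arg_cong[where f=exp]) (simp add: field_simps)
      show ?case
        unfolding p_md_tilt[OF R rho] F_def C_def eq
        by (intro nn_integral_cong) (simp only: ennreal_mult exp_ge_zero mult_ac)
    qed
  qed
  \<comment> \<open>The integral over \<open>g\<close> is exchanged first with the one over
    \<open>x\<close>, then with the one over \<open>y\<close>.\<close>
  also have "\<dots> = (\<integral>\<^sup>+x. \<integral>\<^sup>+g. \<integral>\<^sup>+y. F g x y \<partial>gaussian 0 1 \<partial>gaussian 0 1 \<partial>gaussian 0 (1 / rho))"
    unfolding F_def by (rule NM.Fubini'[symmetric]) measurable
  also have "\<dots> = (\<integral>\<^sup>+x. \<integral>\<^sup>+y. \<integral>\<^sup>+g. F g x y \<partial>gaussian 0 1 \<partial>gaussian 0 1 \<partial>gaussian 0 (1 / rho))"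
    unfolding F_def by (intro nn_integral_cong NN.Fubini'[symmetric]) measurable
  also have "\<dots> = (\<integral>\<^sup>+x. C * (\<integral>\<^sup>+y. acceptance R (x, y) * sphere_mgf d (rho *\<^sub>R x + y) \<partial>gaussian 0 1)
      \<partial>gaussian 0 (1 / rho))"
    unfolding F_def sphere_mgf_def by (simp add: nn_integral_cmult)
  finally show ?thesis
    unfolding C_def .
qed

text \<open>The Neyman--Pearson argument for fixed \<open>x\<close>: the threshold on \<open>norm (rho *\<^sub>R x + y)\<close> is a
  threshold on the likelihood ratio, since \<^const>\<open>sphere_mgf\<close> is a nondecreasing function of the norm.\<close>

lemma discriminant_rule_conditionally_optimal:
  fixes R :: "'n::finite detector"
  assumes R: "R \<in> guaranteed_detectors p" and p: "0 < p" "p < 1"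
  shows "(\<integral>\<^sup>+y. acceptance (discriminant_rule rho p) (x, y) * sphere_mgf d (rho *\<^sub>R x + y) \<partial>gaussian 0 1) \<le>
    (\<integral>\<^sup>+y. acceptance R (x, y) * sphere_mgf d (rho *\<^sub>R x + y) \<partial>gaussian 0 1)"
proof -
  let ?D = "discriminant_rule rho p :: 'n detector"
  define t where "t = chi2_tail_inv TYPE('n) ((norm (rho *\<^sub>R x))\<^sup>2) p"
  have "0 \<le> t"
    unfolding t_def using p by (simp add: chi2_tail_inv_nonneg)
  \<comment> \<open>A vector on the boundary of the acceptance region. Its value \<open>k\<close> of
    the likelihood ratio, up to a constant factor, is the Neyman-Pearson threshold.\<close>
  then obtain u :: "real ^ 'n" where u: "(norm u)\<^sup>2 = t"
    using norm_power2_surj by blast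
  have R': "R \<in> detectors" "p_fa R x \<le> p"
    using R by (auto simp: guaranteed_detectors_def)
  have D: "?D \<in> detectors"
    using p by (rule discriminant_rule_in_detectors)
  note [measurable] = measurable_acceptance[OF R'(1)] measurable_acceptance[OF D]
  define b where "b = acceptance ?D"
  define b' where "b' = acceptance R"
  define h where "h y = sphere_mgf d (rho *\<^sub>R x + y)" for y
  define k where "k = sphere_mgf d u"
  have [measurable]: "h \<in> borel_measurable borel" "b \<in> borel_measurable (borel \<Otimes>\<^sub>M borel)"
      "b' \<in> borel_measurable (borel \<Otimes>\<^sub>M borel)"
    unfolding h_def b_def b'_def by measurable
  \<comment> \<open>This is \<open>(b - b') * (h - k) \<le> 0\<close>, arranged without subtraction
    since the values lie in \<open>ennreal\<close>.\<close>
  have pointwise: "k * b' (x, y) + b (x, y) * h y \<le> b' (x, y) * h y + k * b (x, y)" for y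
  proof (cases "accepts rho p x y")
    case True
    then have "(norm (rho *\<^sub>R x + y))\<^sup>2 \<le> (norm u)\<^sup>2"
      by (simp add: accepts_def t_def u)
    then have "h y \<le> k"
      unfolding h_def k_def by (intro sphere_mgf_mono) (rule power2_le_imp_le, auto)
    \<comment> \<open>Writing 1 as \<open>b' (x, y) + c\<close> again avoids subtraction; the claim
      reduces to \<open>h y * c \<le> k * c\<close>.\<close>
    define c where "c = emeasure (R x y) {True}"
    have c: "b' (x, y) + c = 1"
      unfolding b'_def c_def using R'(1) by (rule acceptance_add_rejection)
    have "k * b' (x, y) + h y * (b' (x, y) + c) \<le> b' (x, y) * h y + k * (b' (x, y) + c)"
      using mult_right_mono[OF \<open>h y \<le> k\<close>, of c, OF zero_le]
      by (simp only: distrib_left mult.commute[of "b' (x, y)"] add_ac) (intro add_right_mono)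
    then show ?thesis
      using True c by (simp add: b_def acceptance_discriminant_rule)
  next
    case False
    then have "(norm u)\<^sup>2 \<le> (norm (rho *\<^sub>R x + y))\<^sup>2"
      by (simp add: accepts_def t_def u)
    then have "k \<le> h y"
      unfolding h_def k_def by (intro sphere_mgf_mono) (rule power2_le_imp_le, auto)
    then show ?thesis
      using False by (simp add: b_def acceptance_discriminant_rule mult.commute[of "b' (x, y)"] mult_right_mono)
  qed
  have "k * (\<integral>\<^sup>+y. b' (x, y) \<partial>gaussian 0 1) + (\<integral>\<^sup>+y. b (x, y) * h y \<partial>gaussian 0 1) =
      (\<integral>\<^sup>+y. k * b' (x, y) + b (x, y) * h y \<partial>gaussian 0 1)"
    by (simp add: nn_integral_add nn_integral_cmult)
  also have "\<dots> \<le> (\<integral>\<^sup>+y. b' (x, y) * h y + k * b (x, y) \<partial>gaussian 0 1)"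
    by (intro nn_integral_mono pointwise)
  also have "\<dots> = k * (\<integral>\<^sup>+y. b (x, y) \<partial>gaussian 0 1) + (\<integral>\<^sup>+y. b' (x, y) * h y \<partial>gaussian 0 1)"
    by (simp add: nn_integral_add nn_integral_cmult add.commute)
  \<comment> \<open>The level enters here: the rule accepts under the null with probability exactly
    \<open>1 - p\<close>, the competitor with at least that.\<close>
  also have "\<dots> \<le> k * (\<integral>\<^sup>+y. b' (x, y) \<partial>gaussian 0 1) + (\<integral>\<^sup>+y. b' (x, y) * h y \<partial>gaussian 0 1)"
    unfolding b_def b'_def one_minus_p_fa[OF D] one_minus_p_fa[OF R'(1)] p_fa_discriminant_rule[OF p]
    using R'(2) by (intro add_right_mono mult_left_mono ennreal_leI) auto
  \<comment> \<open>The common summand may be cancelled because it is finite.\<close>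
  finally have "(\<integral>\<^sup>+y. b (x, y) * h y \<partial>gaussian 0 1) \<le> (\<integral>\<^sup>+y. b' (x, y) * h y \<partial>gaussian 0 1)"
    unfolding b'_def one_minus_p_fa[OF R'(1)] using sphere_mgf_finite[of d u]
    by (auto simp: ennreal_add_left_cancel_le k_def ennreal_mult_eq_top_iff)
  then show ?thesis
    unfolding b_def b'_def h_def .
qed

section \<open>Comparison with a competitor on one sphere\<close>

lemma p_md_discriminant_rule_norm:
  fixes mu nu :: "real ^ 'n"
  assumes "rho > 0" "0 < p" "p < 1" "norm mu = norm nu"
  shows "p_md rho (discriminant_rule rho p) mu = p_md rho (discriminant_rule rho p) nu"
proof -
  obtain f where "orthogonal_transformation f" "f mu = nu"
    using orthogonal_transformation_exists[OF assms(4)] by blast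
  then show ?thesis
    using p_md_discriminant_rule_orthogonal[OF assms(1-3), of f mu] by simp
qed

text \<open>An equalizer argument: the risk of the rule equals its own spherical average, which is
  at most the average risk of \<open>R\<close>, hence at most \<open>B\<close>. In the application
  \<open>B\<close> is the supremum over a whole minimax set.\<close>

lemma p_md_discriminant_rule_le:
  fixes R :: "'n::finite detector" and mu :: "real ^ 'n"
  assumes R: "R \<in> guaranteed_detectors p" and rho: "rho > 0" and p: "0 < p" "p < 1"
    and bound: "\<And>nu :: real ^ 'n. norm nu = norm mu \<Longrightarrow> p_md rho R nu \<le> B"
  shows "p_md rho (discriminant_rule rho p) mu \<le> B"
proof -
  interpret N: prob_space "gaussian (0 :: real ^ 'n) 1"
    by (simp add: prob_space_gaussian)
  let ?D = "discriminant_rule rho p :: 'n detector"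
  have R': "R \<in> detectors"
    using R by (simp add: guaranteed_detectors_def)
  have D: "?D \<in> detectors"
    using p by (rule discriminant_rule_in_detectors)
  have "0 \<le> p_md rho R mu"
    by (simp add: p_md_def)
  \<comment> \<open>The sphere contains \<open>mu\<close> itself; nonnegativity of \<open>B\<close>
    lets the final inequality leave \<open>ennreal\<close>.\<close>
  then have "0 \<le> B"
    using bound[of mu] by simp
  have AE: "AE g in gaussian (0 :: real ^ 'n) 1. norm (norm mu *\<^sub>R sgn g) = norm mu"
    by (intro AE_norm_sgn_gaussian) simp
  have "ennreal (p_md rho ?D mu) = (\<integral>\<^sup>+g. ennreal (p_md rho ?D mu) \<partial>gaussian (0 :: real ^ 'n) 1)"
    by (simp add: N.emeasure_space_1[simplified])
  also have "\<dots> = (\<integral>\<^sup>+g. ennreal (p_md rho ?D (norm mu *\<^sub>R sgn g)) \<partial>gaussian 0 1)"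
  proof (rule nn_integral_cong_AE)
    show "AE g in gaussian 0 1. ennreal (p_md rho ?D mu) = ennreal (p_md rho ?D (norm mu *\<^sub>R sgn g))"
      using AE
    proof eventually_elim
      case (elim g)
      have "p_md rho ?D mu = p_md rho ?D (norm mu *\<^sub>R sgn g)"
        by (rule p_md_discriminant_rule_norm[OF rho p elim[symmetric]])
      then show ?case
        by (rule arg_cong)
    qed
  qed
  also have "\<dots> \<le> (\<integral>\<^sup>+g. ennreal (p_md rho R (norm mu *\<^sub>R sgn g)) \<partial>gaussian 0 1)"
    unfolding p_md_sphere_average[OF D rho norm_ge_zero] p_md_sphere_average[OF R' rho norm_ge_zero]
    by (rule nn_integral_mono, rule mult_left_mono[OF discriminant_rule_conditionally_optimal[OF R p]]) simp
  also have "\<dots> \<le> (\<integral>\<^sup>+g. ennreal B \<partial>gaussian (0 :: real ^ 'n) 1)"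
  proof (rule nn_integral_mono_AE)
    show "AE g in gaussian 0 1. ennreal (p_md rho R (norm mu *\<^sub>R sgn g)) \<le> ennreal B"
      using AE by eventually_elim (intro ennreal_leI bound)
  qed
  also have "\<dots> = ennreal B"
    by (simp add: N.emeasure_space_1[simplified])
  finally show ?thesis
    using \<open>0 \<le> B\<close> by simp
qed

section \<open>Rotation invariance of the minimax sets\<close>

text \<open>Composing a test with \<open>f\<close> turns a test against \<open>f mu\<close> into one
  against \<open>mu\<close>, with the same false-alarm probability because \<open>f\<close> fixes
  the origin. Using this for \<open>f\<close> and for its inverse shows that the two sets of
  attainable values agree.\<close>

lemma opt_md_orthogonal:
  fixes f :: "real ^ 'n \<Rightarrow> real ^ 'n"
  assumes f: "orthogonal_transformation f"
  shows "opt_md p (f mu) = opt_md p mu"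
proof -
  let ?S = "{T \<in> tests. test_fa T \<le> p}"
  have sub: "(\<lambda>T. test_md T (f mu)) ` ?S \<subseteq> (\<lambda>T. test_md T mu) ` ?S"
    if f: "orthogonal_transformation f" for f :: "real ^ 'n \<Rightarrow> real ^ 'n" and mu
  proof -
    have fm: "f \<in> borel_measurable borel"
      using f by (rule measurable_orthogonal_transformation)
    have bind: "gaussian (f nu) 1 \<bind> T = gaussian nu 1 \<bind> (\<lambda>y. T (f y))" if "T \<in> tests" for T nu
    proof -
      have "T \<in> borel \<rightarrow>\<^sub>M subprob_algebra decision_space"
        using that by (intro measurable_prob_algebraD) (simp add: tests_def)
      then have "distr (gaussian nu 1) borel f \<bind> T = gaussian nu 1 \<bind> (\<lambda>y. T (f y))"
        using fm by (intro bind_distr) auto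
      then show ?thesis
        using f by (simp add: distr_gaussian_orthogonal)
    qed
    have "f 0 = 0"
      using f by (simp add: linear_0 orthogonal_transformation_linear)
    have "(\<lambda>y. T (f y)) \<in> ?S \<and> test_md T (f mu) = test_md (\<lambda>y. T (f y)) mu" if T: "T \<in> ?S" for T
      using T bind[of T 0] bind[of T mu] \<open>f 0 = 0\<close> measurable_compose[OF fm, of T]
      by (simp add: test_fa_def test_md_def tests_def)
    then show ?thesis
      by blast
  qed
  have inv: "orthogonal_transformation (inv f)" "inv f (f mu) = mu"
    using f orthogonal_transformation_bij[OF f]
    by (auto simp: orthogonal_transformation_inv bij_is_inj)
  have "(\<lambda>T. test_md T (f mu)) ` ?S = (\<lambda>T. test_md T mu) ` ?S"
    using sub[OF f, of mu] sub[OF inv(1), of "f mu"] unfolding inv(2) by (rule subset_antisym)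
  then show ?thesis
    unfolding opt_md_def by (rule arg_cong)
qed

text \<open>Rotations act transitively on spheres, and membership of a nonzero vector is decided by
  \<open>opt_md\<close> alone.\<close>

lemma minimax_set_norm:
  assumes "mu1 \<in> minimax_set mu" "norm nu = norm mu1"
  shows "nu \<in> minimax_set mu"
proof -
  obtain f where "orthogonal_transformation f" "f nu = mu1"
    using orthogonal_transformation_exists[OF assms(2)] by blast
  then have "opt_md p nu = opt_md p mu1" for p
    using opt_md_orthogonal by metis
  then show ?thesis
    using assms by (auto simp: minimax_set_def harder_def)
qed

section \<open>From spheres to minimax sets, and the missed-detection formula\<close>

theorem theorem1:
  fixes rho p :: real
  assumes "rho > 0" and "0 < p" and "p < 1"
  shows "umm_detector rho p (discriminant_rule rho p :: 'n::finite detector) \<and>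
    (\<exists>p_umm :: real \<Rightarrow> real. \<forall>mu1 :: real ^ 'n. mu1 \<noteq> 0 \<longrightarrow>
       p_md rho (discriminant_rule rho p) mu1 = p_umm (norm mu1) \<and>
       p_umm (norm mu1) = 1 - (\<integral>x. chi2_tail TYPE('n) ((norm (rho *\<^sub>R x + mu1))\<^sup>2)
            (chi2_tail_inv TYPE('n) ((norm (rho *\<^sub>R x))\<^sup>2) p) \<partial>gaussian mu1 (1 / rho)))"
proof
  let ?D = "discriminant_rule rho p :: 'n detector"
  show "umm_detector rho p ?D"
    unfolding umm_detector_def
  proof (intro conjI allI impI ballI)
    show "?D \<in> guaranteed_detectors p"
      using assms by (simp add: guaranteed_detectors_def discriminant_rule_in_detectors p_fa_discriminant_rule)
    fix mu :: "real ^ 'n" and R :: "'n detector"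
    assume mu: "mu \<noteq> 0" and R: "R \<in> guaranteed_detectors p"
    show "(SUP mu1\<in>minimax_set mu. p_md rho ?D mu1) \<le> (SUP mu1\<in>minimax_set mu. p_md rho R mu1)"
    proof (rule cSUP_least)
      \<comment> \<open>\<open>harder\<close> is reflexive, so \<open>mu\<close> belongs to its own
        minimax set.\<close>
      show "minimax_set mu \<noteq> {}"
        using mu by (auto simp: minimax_set_def harder_def)
      fix mu1 assume mu1: "mu1 \<in> minimax_set mu"
      show "p_md rho ?D mu1 \<le> (SUP mu1\<in>minimax_set mu. p_md rho R mu1)"
      \<comment> \<open>The sphere through \<open>mu1\<close> stays inside the minimax set, so the
        competitor's supremum bounds its risk there.\<close>
      proof (rule p_md_discriminant_rule_le[OF R assms])
        fix nu :: "real ^ 'n" assume "norm nu = norm mu1"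
        then show "p_md rho R nu \<le> (SUP mu1\<in>minimax_set mu. p_md rho R mu1)"
          using R assms(1) minimax_set_norm[OF mu1]
          by (intro cSUP_upper bdd_aboveI2[of _ _ 1] p_md_le_1) (auto simp: guaranteed_detectors_def)
      qed
    qed
  qed
  \<comment> \<open>The risk at an arbitrary vector of norm \<open>r\<close>. For negative
    \<open>r\<close> the choice is unspecified, but only norms are inserted.\<close>
  define p_umm where "p_umm r = p_md rho ?D (SOME mu. norm mu = r)" for r
  have "p_md rho ?D mu = p_umm (norm mu)" for mu
  proof -
    have "norm (SOME nu :: real ^ 'n. norm nu = norm mu) = norm mu"
      by (rule someI) (rule refl)
    then show ?thesis
      unfolding p_umm_def by (intro p_md_discriminant_rule_norm[OF assms]) simp
  qed
  then show "\<exists>p_umm :: real \<Rightarrow> real. \<forall>mu1 :: real ^ 'n. mu1 \<noteq> 0 \<longrightarrow>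
       p_md rho (discriminant_rule rho p) mu1 = p_umm (norm mu1) \<and>
       p_umm (norm mu1) = 1 - (\<integral>x. chi2_tail TYPE('n) ((norm (rho *\<^sub>R x + mu1))\<^sup>2)
            (chi2_tail_inv TYPE('n) ((norm (rho *\<^sub>R x))\<^sup>2) p) \<partial>gaussian mu1 (1 / rho))"
    using p_md_discriminant_rule[OF assms, where 'n='n] by metis
qed

end
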